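(* Let $p,q\ge 0$ be integers and let $a_1,\dots,a_p,b_1,\dots,b_q$ be arbitrary constants. For every integer $N\ge 0$ put $$F_N(x)={}_{p+N+1}F_{q+N+1}\Bigl(a_1,\dots,a_p,\tfrac{\alpha+1}{\gamma},\tfrac{\alpha+\beta+1}{\gamma},\dots,\tfrac{\alpha+N\beta+1}{\gamma};\,b_1,\dots,b_q,\tfrac{\alpha+\gamma+1}{\gamma},\tfrac{\alpha+\gamma+\beta+1}{\gamma},\dots,\tfrac{\alpha+\gamma+N\beta+1}{\gamma};\,\lambda x^{\gamma}\Bigr).$$ Then, for any constants $\alpha,\beta,\eta,\lambda$ and any nonzero constant $\gamma$, $$e^{i\eta x^\beta}\sum_{j=0}^{\infty}\frac{(-i\beta\eta x^\beta)^{j}}{\prod_{m=0}^{j}(\alpha+m\beta+1)}F_{j}(x) =\cos(\eta x^\beta)\sum_{j=0}^{\infty}\frac{(-1)^j(\beta\eta x^\beta)^{2j}}{\prod_{m=0}^{2j}(\alpha+m\beta+1)}F_{2j}(x)+\sin(\eta x^\beta)\sum_{j=0}^{\infty}\frac{(-1)^j(\beta\eta x^\beta)^{2j+1}}{\prod_{m=0}^{2j+1}(\alpha+m\beta+1)}F_{2j+1}(x)$$ $$+i\sin(\eta x^\beta)\sum_{j=0}^{\infty}\frac{(-1)^j(\beta\eta x^\beta)^{2j}}{\prod_{m=0}^{2j}(\alpha+m\beta+1)}F_{2j}(x)-i\cos(\eta x^\beta)\sum_{j=0}^{\infty}\frac{(-1)^j(\beta\eta x^\beta)^{2j+1}}{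\prod_{m=0}^{2j+1}(\alpha+m\beta+1)}F_{2j+1}(x).$$
   Context: Constants are real or complex; $i$ is the imaginary unit. The generalized hypergeometric function is defined by the series $${}_pF_q(a_1,\dots,a_p;b_1,\dots,b_q;x)=\sum_{n=0}^{\infty}\frac{(a_1)_n\cdots(a_p)_n}{(b_1)_n\cdots(b_q)_n}\frac{x^n}{n!},$$ with Pochhammer symbol $(\vartheta)_n=\Gamma(\vartheta+n)/\Gamma(\vartheta)$, $(\vartheta)_0=1$.
   Formalization: For arbitrary constants the series need not converge (small divisors when γ/β is negative), so the identity is stated under the condition that the two series on the right, over even and odd indices, converge; convergence of the left series is then part of the conclusion. *)

theory Defs
  imports "HOL-Analysis.Analysis"
begin

definition pFq :: "complex list \<Rightarrow> complex list \<Rightarrow> complex \<Rightarrow> complex" where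
  "pFq a b x = (\<Sum>n. (\<Prod>c\<leftarrow>a. pochhammer c n) / (\<Prod>d\<leftarrow>b. pochhammer d n) * (x ^ n / fact n))"

lemma pFq_eval_fps: "pFq a b x = eval_fps (fps_hypergeo a b 1) x"
proof -
  have foldl_prod: "foldl (\<lambda>r c. r * pochhammer c n) u cs = u * (\<Prod>c\<leftarrow>cs. pochhammer c n)"
    for n and u :: complex and cs
    by (induction cs arbitrary: u) (simp_all add: mult.assoc)
  show ?thesis
    by (simp add: pFq_def eval_fps_def fps_hypergeo_def foldl_prod field_simps)
qed

text \<open>The order of the function below is given by the lists: \<open>p = length a\<close>, \<open>q = length b\<close>,
  so that it is a \<open>p + N + 1\<close>-over-\<open>q + N + 1\<close> hypergeometric function.
  Powers of \<open>x\<close> are principal branches.\<close>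

definition F_ext ::
  "complex list \<Rightarrow> complex list \<Rightarrow> complex \<Rightarrow> complex \<Rightarrow> complex \<Rightarrow> complex \<Rightarrow> nat \<Rightarrow> complex \<Rightarrow> complex"
where
  "F_ext a b \<alpha> \<beta> \<gamma> lam N x =
     pFq (a @ map (\<lambda>m. (\<alpha> + of_nat m * \<beta> + 1) / \<gamma>) [0..<Suc N])
         (b @ map (\<lambda>m. (\<alpha> + \<gamma> + of_nat m * \<beta> + 1) / \<gamma>) [0..<Suc N])
         (lam * x powr \<gamma>)"

end

theory Submission
  imports Defs
begin

text \<open>
  With \<open>z = \<beta> \<eta> x\<^sup>\<beta>\<close>, the series on the left has terms \<open>(-\<i> z)\<^sup>j u\<^sub>j\<close>, where \<open>u\<^sub>j\<close> is the
  hypergeometric factor divided by the product. Since \<open>(-\<i>)\<^sup>2 = -1\<close>, its even-indexed terms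
  are exactly the \<open>(-1)\<^sup>j z\<^sup>2\<^sup>j u\<^sub>2\<^sub>j\<close> of the cosine-type series, and its odd-indexed terms are those of the
  sine-type series times \<open>-\<i>\<close>. So the sum is \<open>A - \<i> B\<close>, with \<open>A\<close> and \<open>B\<close> the sums of the two
  series (lemmas \<open>sums_even_odd\<close> and \<open>sums_alternating_split\<close>), and expanding
  \<open>(cos \<theta> + \<i> sin \<theta>) (A - \<i> B)\<close> by Euler's formula with \<open>\<theta> = \<eta> x\<^sup>\<beta>\<close> gives the four terms.
\<close>

text \<open>Conditional convergence is enough here: padding each parity class with zeros changes
  neither its convergence nor its sum, and the full series is the termwise sum of the two padded
  series, so nothing is rearranged.\<close>

lemma sums_even_odd:
  fixes f :: "nat \<Rightarrow> 'a::real_normed_vector"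
  assumes "(\<lambda>j. f (2 * j)) sums A" and "(\<lambda>j. f (2 * j + 1)) sums B"
  shows "f sums (A + B)"
proof -
  have "(\<lambda>n. if even n then f n else 0) sums A"
    using assms(1)
    by (subst sums_mono_reindex[of "\<lambda>j. 2 * j", symmetric]) (auto simp: strict_mono_def)
  moreover have "(\<lambda>n. if odd n then f n else 0) sums B"
    using assms(2)
    by (subst sums_mono_reindex[of "\<lambda>j. 2 * j + 1", symmetric])
      (auto simp: strict_mono_def elim!: oddE)
  ultimately have "(\<lambda>n. (if even n then f n else 0) + (if odd n then f n else 0)) sums (A + B)"
    by (rule sums_add)
  moreover have "(\<lambda>n. (if even n then f n else 0) + (if odd n then f n else 0)) = f"
    by auto
  ultimately show ?thesis
    by simp
qed

lemma sums_alternating_split: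
  fixes u :: "nat \<Rightarrow> complex" and z A B :: complex
  assumes even: "(\<lambda>j. (-1) ^ j * z ^ (2 * j) * u (2 * j)) sums A"
    and odd: "(\<lambda>j. (-1) ^ j * z ^ (2 * j + 1) * u (2 * j + 1)) sums B"
  shows "(\<lambda>j. (-(\<i> * z)) ^ j * u j) sums (A - \<i> * B)"
proof -
  have "(-(\<i> * z)) ^ 2 = -1 * z ^ 2"
    by (simp add: power_mult_distrib)
  then have pow_even: "(-(\<i> * z)) ^ (2 * j) = (-1) ^ j * z ^ (2 * j)" for j
    by (simp only: power_mult power_mult_distrib)
  have pow_odd: "(-(\<i> * z)) ^ (2 * j + 1) = -\<i> * ((-1) ^ j * z ^ (2 * j + 1))" for j
    unfolding power_add pow_even by simp
  have "(\<lambda>j. (-(\<i> * z)) ^ (2 * j) * u (2 * j)) sums A"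
    using even unfolding pow_even .
  moreover have "(\<lambda>j. (-(\<i> * z)) ^ (2 * j + 1) * u (2 * j + 1)) sums (-\<i> * B)"
    using sums_mult[OF odd, of "-\<i>"] unfolding pow_odd by (simp only: mult.assoc)
  ultimately have "(\<lambda>j. (-(\<i> * z)) ^ j * u j) sums (A + -\<i> * B)"
    by (rule sums_even_odd)
  then show ?thesis
    by simp
qed

theorem theorem6:
  fixes a b :: "complex list" and \<alpha> \<beta> \<gamma> \<eta> lam x :: complex
  assumes "\<gamma> \<noteq> 0"
    and "summable (\<lambda>j. (-1) ^ j * (\<beta> * \<eta> * x powr \<beta>) ^ (2 * j) / (\<Prod>m\<le>2 * j. \<alpha> + of_nat m * \<beta> + 1) * F_ext a b \<alpha> \<beta> \<gamma> lam (2 * j) x)"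
    and "summable (\<lambda>j. (-1) ^ j * (\<beta> * \<eta> * x powr \<beta>) ^ (2 * j + 1) / (\<Prod>m\<le>2 * j + 1. \<alpha> + of_nat m * \<beta> + 1) * F_ext a b \<alpha> \<beta> \<gamma> lam (2 * j + 1) x)"
  shows "summable (\<lambda>j. (-(\<i> * \<beta> * \<eta> * x powr \<beta>)) ^ j / (\<Prod>m\<le>j. \<alpha> + of_nat m * \<beta> + 1) * F_ext a b \<alpha> \<beta> \<gamma> lam j x) \<and>
    exp (\<i> * \<eta> * x powr \<beta>) *
      (\<Sum>j. (-(\<i> * \<beta> * \<eta> * x powr \<beta>)) ^ j / (\<Prod>m\<le>j. \<alpha> + of_nat m * \<beta> + 1) * F_ext a b \<alpha> \<beta> \<gamma> lam j x)
    = cos (\<eta> * x powr \<beta>) *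
        (\<Sum>j. (-1) ^ j * (\<beta> * \<eta> * x powr \<beta>) ^ (2 * j) / (\<Prod>m\<le>2 * j. \<alpha> + of_nat m * \<beta> + 1) * F_ext a b \<alpha> \<beta> \<gamma> lam (2 * j) x)
      + sin (\<eta> * x powr \<beta>) *
        (\<Sum>j. (-1) ^ j * (\<beta> * \<eta> * x powr \<beta>) ^ (2 * j + 1) / (\<Prod>m\<le>2 * j + 1. \<alpha> + of_nat m * \<beta> + 1) * F_ext a b \<alpha> \<beta> \<gamma> lam (2 * j + 1) x)
      + \<i> * sin (\<eta> * x powr \<beta>) *
        (\<Sum>j. (-1) ^ j * (\<beta> * \<eta> * x powr \<beta>) ^ (2 * j) / (\<Prod>m\<le>2 * j. \<alpha> + of_nat m * \<beta> + 1) * F_ext a b \<alpha> \<beta> \<gamma> lam (2 * j) x)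
      - \<i> * cos (\<eta> * x powr \<beta>) *
        (\<Sum>j. (-1) ^ j * (\<beta> * \<eta> * x powr \<beta>) ^ (2 * j + 1) / (\<Prod>m\<le>2 * j + 1. \<alpha> + of_nat m * \<beta> + 1) * F_ext a b \<alpha> \<beta> \<gamma> lam (2 * j + 1) x)"
proof -
  let ?z = "\<beta> * \<eta> * x powr \<beta>"
  let ?u = "\<lambda>j. F_ext a b \<alpha> \<beta> \<gamma> lam j x / (\<Prod>m\<le>j. \<alpha> + of_nat m * \<beta> + 1)"
  define A where "A = (\<Sum>j. (-1) ^ j * ?z ^ (2 * j) / (\<Prod>m\<le>2 * j. \<alpha> + of_nat m * \<beta> + 1) * F_ext a b \<alpha> \<beta> \<gamma> lam (2 * j) x)"
  define B where "B = (\<Sum>j. (-1) ^ j * ?z ^ (2 * j + 1) / (\<Prod>m\<le>2 * j + 1. \<alpha> + of_nat m * \<beta> + 1) * F_ext a b \<alpha> \<beta> \<gamma> lam (2 * j + 1) x)"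
  have "(\<lambda>j. (-1) ^ j * ?z ^ (2 * j) * ?u (2 * j)) sums A"
    using summable_sums[OF assms(2)] unfolding A_def times_divide_eq_left times_divide_eq_right .
  moreover have "(\<lambda>j. (-1) ^ j * ?z ^ (2 * j + 1) * ?u (2 * j + 1)) sums B"
    using summable_sums[OF assms(3)] unfolding B_def times_divide_eq_left times_divide_eq_right .
  ultimately have "(\<lambda>j. (-(\<i> * ?z)) ^ j * ?u j) sums (A - \<i> * B)"
    by (rule sums_alternating_split)
  then have full: "(\<lambda>j. (-(\<i> * \<beta> * \<eta> * x powr \<beta>)) ^ j / (\<Prod>m\<le>j. \<alpha> + of_nat m * \<beta> + 1) * F_ext a b \<alpha> \<beta> \<gamma> lam j x) sums (A - \<i> * B)"
    by (simp only: times_divide_eq_left times_divide_eq_right mult.assoc)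
  have "exp (\<i> * \<eta> * x powr \<beta>) = cos (\<eta> * x powr \<beta>) + \<i> * sin (\<eta> * x powr \<beta>)"
    by (simp add: exp_Euler mult.assoc)
  then have "exp (\<i> * \<eta> * x powr \<beta>) * (A - \<i> * B)
    = cos (\<eta> * x powr \<beta>) * A + sin (\<eta> * x powr \<beta>) * B
      + \<i> * sin (\<eta> * x powr \<beta>) * A - \<i> * cos (\<eta> * x powr \<beta>) * B"
    by (simp add: algebra_simps)
  then show ?thesis
    unfolding sums_unique[OF full, symmetric] A_def[symmetric] B_def[symmetric]
    using sums_summable[OF full] by blast
qed

end
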